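(* Let $A$ be an infinite abelian group that has no involutions. Then there exists a projective plane $\Gamma$ such that $A \leq \mathrm{Aut}(\Gamma)$ and $A$ acts sharply transitively on the points of $\Gamma$.
   Context: An involution is a group element of order exactly $2$. A projective plane is an axiomatic (not necessarily Desarguesian) projective plane; $\mathrm{Aut}(\Gamma)$ is its group of automorphisms (collineations). A group acts sharply transitively on a set if for any two elements $x,y$ of the set there is exactly one group element mapping $x$ to $y$. The notation $A \leq \mathrm{Aut}(\Gamma)$ means that $A$ is isomorphic to a subgroup of $\mathrm{Aut}(\Gamma)$, with the action being that of this subgroup. *)

theory Defs
  imports "HOL-Algebra.Bij" "HOL-Algebra.Multiplicative_Group"
begin

text \<open>
  A projective plane is given by its set of points and its set of lines, where a line is
  identified with the set of points incident with it.
\<close>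

locale projective_plane =
  fixes points :: "'p set" and lines :: "'p set set"
  assumes line_subset: "l \<in> lines \<Longrightarrow> l \<subseteq> points"
    and join: "\<lbrakk>x \<in> points; y \<in> points; x \<noteq> y\<rbrakk> \<Longrightarrow> \<exists>!l. l \<in> lines \<and> x \<in> l \<and> y \<in> l"
    and meet: "\<lbrakk>l \<in> lines; m \<in> lines; l \<noteq> m\<rbrakk> \<Longrightarrow> \<exists>!x. x \<in> points \<and> x \<in> l \<and> x \<in> m"
    \<comment> \<open>there are four points, no three of which are collinear\<close>
    and quadrangle: "\<exists>Q \<subseteq> points. card Q = 4 \<and> (\<forall>l \<in> lines. card (Q \<inter> l) \<le> 2)"

definition collineations :: "'p set \<Rightarrow> 'p set set \<Rightarrow> ('p \<Rightarrow> 'p) set" where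
  "collineations P L = {f \<in> Bij P. (\<lambda>l. f ` l) ` L = L}"

definition Aut :: "'p set \<Rightarrow> 'p set set \<Rightarrow> ('p \<Rightarrow> 'p) monoid" where
  "Aut P L = BijGroup P \<lparr>carrier := collineations P L\<rparr>"

lemma (in projective_plane) subgroup_collineations:
  "subgroup (collineations points lines) (BijGroup points)"
proof -
  interpret B: group "BijGroup points" by (rule group_BijGroup)
  have inv: "inv\<^bsub>BijGroup points\<^esub> f = (\<lambda>x\<in>points. inv_into points f x)" if "f \<in> Bij points" for f
    by (rule inv_BijGroup[OF that])
  show ?thesis
  proof (rule B.subgroupI)
    show "collineations points lines \<subseteq> carrier (BijGroup points)"
      by (auto simp: collineations_def BijGroup_def)
    have "(\<lambda>x\<in>points. x) ` l = l" if "l \<in> lines" for l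
      
    proof -
      have "(\<lambda>x\<in>points. x) ` l = (\<lambda>x. x) ` l"
        using line_subset[OF that] by (intro image_cong[OF refl]) auto
      then show ?thesis by (simp only: image_ident)
    qed
    then have "(\<lambda>l. (\<lambda>x\<in>points. x) ` l) ` lines = (\<lambda>l. l) ` lines"
      by (rule image_cong[OF refl])
    then have "(\<lambda>x\<in>points. x) \<in> collineations points lines"
      by (simp add: collineations_def id_Bij)
    then show "collineations points lines \<noteq> {}" by blast
  next
    fix f assume f: "f \<in> collineations points lines"
    then have fB: "f \<in> Bij points" and fL: "(\<lambda>l. f ` l) ` lines = lines"
      by (auto simp: collineations_def)
    let ?g = "\<lambda>x\<in>points. inv_into points f x"
    have gf: "?g ` f ` l = l" if "l \<in> lines" for l
    proof -
      have "?g (f x) = x" if "x \<in> points" for x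
        using fB that by (auto simp: Bij_def bij_betw_def)
      then have "(\<lambda>x. ?g (f x)) ` l = (\<lambda>x. x) ` l"
        using line_subset[OF that] by (intro image_cong[OF refl]) blast
      then show ?thesis by (simp only: image_image image_ident)
    qed
    have "(\<lambda>l. ?g ` l) ` lines = (\<lambda>l. ?g ` l) ` (\<lambda>l. f ` l) ` lines"
      by (simp only: fL)
    also have "\<dots> = (\<lambda>l. ?g ` f ` l) ` lines"
      by (simp only: image_image)
    also have "\<dots> = (\<lambda>l. l) ` lines"
      using gf by (rule image_cong[OF refl])
    also have "\<dots> = lines"
      by (rule image_ident)
    finally show "inv\<^bsub>BijGroup points\<^esub> f \<in> collineations points lines"
      using inv[OF fB] restrict_inv_into_Bij[OF fB] by (simp add: collineations_def)
  next
    fix f g assume f: "f \<in> collineations points lines" and g: "g \<in> collineations points lines"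
    then have fB: "f \<in> Bij points" "g \<in> Bij points"
      and fL: "(\<lambda>l. f ` l) ` lines = lines" "(\<lambda>l. g ` l) ` lines = lines"
      by (auto simp: collineations_def)
    have c: "compose points f g ` l = f ` g ` l" if "l \<in> lines" for l
    proof -
      have "compose points f g ` l = (\<lambda>x. f (g x)) ` l"
        using line_subset[OF that] by (intro image_cong[OF refl]) (auto simp: compose_def)
      then show ?thesis by (simp only: image_image)
    qed
    have "(\<lambda>l. compose points f g ` l) ` lines = (\<lambda>l. f ` g ` l) ` lines"
      using c by (rule image_cong[OF refl])
    also have "\<dots> = (\<lambda>l. f ` l) ` (\<lambda>l. g ` l) ` lines"
      by (simp only: image_image)
    also have "\<dots> = lines" by (simp only: fL)
    finally show "f \<otimes>\<^bsub>BijGroup points\<^esub> g \<in> collineations points lines"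
      using fB by (simp add: collineations_def BijGroup_def compose_Bij)
  qed
qed

lemma (in projective_plane) group_Aut: "group (Aut points lines)"
  unfolding Aut_def
  by (rule subgroup.subgroup_is_group[OF subgroup_collineations group_BijGroup])

definition sharply_transitive :: "('a, 'b) monoid_scheme \<Rightarrow> ('a \<Rightarrow> 'p \<Rightarrow> 'p) \<Rightarrow> 'p set \<Rightarrow> bool" where
  "sharply_transitive G \<phi> X \<longleftrightarrow> (\<forall>x \<in> X. \<forall>y \<in> X. \<exists>!g. g \<in> carrier G \<and> \<phi> g x = y)"

definition has_involution :: "('a, 'b) monoid_scheme \<Rightarrow> bool" where
  "has_involution G \<longleftrightarrow> (\<exists>x \<in> carrier G. group.ord G x = 2)"

end

theory Submission
  imports Defs
begin

text \<open>
  Write the group multiplicatively, and let it be infinite. If a subset \<open>D\<close> has the property that every \<open>g \<noteq> \<one>\<close> is a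
  quotient \<open>b / a\<close> of elements of \<open>D\<close> in exactly one way (a planar difference set), then the
  translates \<open>g D\<close> are the lines of a projective plane whose points are the group elements: both
  the line through \<open>x \<noteq> y\<close> and the common point of \<open>h D \<noteq> k D\<close> come from writing one
  nontrivial element as a quotient, \<open>y / x\<close> in the first case and \<open>h / k\<close> in the second. The group
  permutes the lines by translation, and its regular action on itself is sharply transitive.

  Uniqueness of quotients says that \<open>D\<close> is a Sidon set: \<open>a b = c d\<close> only if the pairs
  \<open>{a, b}\<close> and \<open>{c, d}\<close> agree. A Sidon set representing all \<open>g\<close> is built by transfinite
  recursion along a well-order of the group in which proper initial segments are smaller than the
  group (\<open>transfinite_extension\<close>). At each stage the set \<open>S\<close> built so far is smaller than the
  group, and if \<open>g\<close> is not yet a quotient, two elements \<open>x\<close> and \<open>g x\<close> are added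
  (\<open>sidon_extend_quotient\<close>). The Sidon property survives unless \<open>x\<close> or \<open>x\<^sup>2\<close> lies in a set of
  short words over \<open>S \<union> {\<one>, g}\<close>, which is smaller than the group. Without involutions squaring is
  injective, so fewer than \<open>|A|\<close> choices of \<open>x\<close> are forbidden (\<open>exists_generic_element\<close>).
  The same hypothesis rules out \<open>g\<^sup>2 = \<one>\<close>, in which case \<open>g = (g x) / x = x / (g x)\<close> would be
  represented twice.
\<close>

unbundle cardinal_syntax

section \<open>Transfinite construction by small steps\<close>

lemma finite_ordLess_card: "\<lbrakk>finite X; infinite B\<rbrakk> \<Longrightarrow> |X| <o |B|"
  by (intro finite_ordLess_infinite) (simp_all add: card_of_well_order_on Field_card_of)

text \<open>
  For infinite \<open>I\<close> the union has at most \<open>|I|\<close> elements. Finiteness of the members is what makes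
  this true for singular cardinals \<open>|B|\<close> as well.
\<close>

lemma ordLess_UNION_finite:
  assumes "infinite B" and "|I| <o |B|" and fin: "\<And>i. i \<in> I \<Longrightarrow> finite (F i)"
  shows "|\<Union>i\<in>I. F i| <o |B|"
proof (cases "finite I")
  case True
  then have "finite (\<Union>i\<in>I. F i)" using fin by blast
  then show ?thesis
    using assms(1) by (intro finite_ordLess_card)
next
  case False
  have "|F i| \<le>o |I|" if "i \<in> I" for i
    using fin[OF that] False
    by (intro ordLess_imp_ordLeq finite_ordLess_card)
  then have "|\<Union>i\<in>I. F i| \<le>o |I|"
    using False by (intro card_of_UNION_ordLeq_infinite) (auto simp: card_of_mono1)
  then show ?thesis using assms(2) by (rule ordLeq_ordLess_trans)
qed

lemma ordLess_Times_same:
  assumes "infinite B" and "|K| <o |B|"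
  shows "|K \<times> K| <o |B|"
proof (cases "finite K")
  case True
  then show ?thesis
    using assms(1) by (intro finite_ordLess_card finite_cartesian_product)
next
  case False
  then show ?thesis
    using card_of_Times_same_infinite assms(2) ordIso_ordLess_trans by blast
qed

text \<open>
  A property preserved by unions of chains can be steered to satisfy one requirement for each index
  in \<open>I\<close>. The indices are well-ordered by the cardinal of \<open>I\<close>, so a stage has fewer than \<open>|I|\<close>
  predecessors; as each stage contributes finitely many elements, the set accumulated before it
  has cardinality below \<open>|I|\<close>, which is what the step hypothesis asks for. Requirements met once
  stay met because they are monotone.
\<close>

lemma transfinite_extension:
  fixes P :: "'a set \<Rightarrow> bool" and R :: "'i \<Rightarrow> 'a set \<Rightarrow> bool"
  assumes inf: "infinite I"
    and chain: "\<And>\<C>. \<lbrakk>\<And>X. X \<in> \<C> \<Longrightarrow> P X; \<And>X Y. \<lbrakk>X \<in> \<C>; Y \<in> \<C>\<rbrakk> \<Longrightarrow> X \<subseteq> Y \<or> Y \<subseteq> X\<rbrakk> \<Longrightarrow> P (\<Union>\<C>)"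
    and mono: "\<And>i X Y. \<lbrakk>R i X; X \<subseteq> Y\<rbrakk> \<Longrightarrow> R i Y"
    and step: "\<And>i X. \<lbrakk>i \<in> I; P X; |X| <o |I|\<rbrakk> \<Longrightarrow> \<exists>T. finite T \<and> P (X \<union> T) \<and> R i (X \<union> T)"
  obtains D where "P D" and "\<And>i. i \<in> I \<Longrightarrow> R i D"
proof -
  let ?r = "|I|"
  have wo: "well_order_on I ?r" by (rule card_of_well_order_on)
  then have wf: "wf (?r - Id)" and tot: "total_on I ?r" and tr: "trans ?r" and anti: "antisym ?r"
    by (auto simp: well_order_on_def linear_order_on_def partial_order_on_def preorder_on_def)
  have Fld: "(h, i) \<in> ?r \<Longrightarrow> h \<in> I \<and> i \<in> I" for h i
    using Field_card_of[of I] by (auto simp: Field_def)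
  (* T i is the finite contribution of stage i, and D i is what the earlier stages have built. *)
  define E where "E i X = (SOME T. finite T \<and> P (X \<union> T) \<and> R i (X \<union> T))" for i X
  define T where "T = wfrec (?r - Id) (\<lambda>f i. E i (\<Union>h\<in>underS ?r i. f h))"
  define D where "D i = (\<Union>h\<in>underS ?r i. T h)" for i
  have T: "T i = E i (D i)" for i
  proof -
    have "T i = E i (\<Union>h\<in>underS ?r i. cut T (?r - Id) i h)"
      unfolding T_def by (subst wfrec[OF wf]) simp
    moreover have "(\<Union>h\<in>underS ?r i. cut T (?r - Id) i h) = D i"
      unfolding D_def by (rule SUP_cong) (auto simp: cut_def underS_def)
    ultimately show ?thesis by simp
  qed
  have sub: "D h \<union> T h \<subseteq> D i" if "(h, i) \<in> ?r" "h \<noteq> i" for h i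
  proof -
    have "underS ?r h \<subseteq> underS ?r i"
      using that tr anti by (auto simp: underS_def dest: transD antisymD)
    then show ?thesis using that by (auto simp: D_def underS_def)
  qed
  have cmp: "D h \<union> T h \<subseteq> D i \<union> T i \<or> D i \<union> T i \<subseteq> D h \<union> T h" if hi: "h \<in> I" "i \<in> I" for h i
  proof -
    consider "h = i" | "(h, i) \<in> ?r" "h \<noteq> i" | "(i, h) \<in> ?r" "i \<noteq> h"
      using tot[unfolded total_on_def, rule_format, OF hi] by blast
    then show ?thesis
    proof cases
      case 2
      then show ?thesis using sub by (intro disjI1 le_supI1)
    next
      case 3
      then show ?thesis using sub by (intro disjI2 le_supI1)
    qed simp
  qed
  have P_UN: "P (\<Union>((\<lambda>i. D i \<union> T i) ` J))"
    if J: "J \<subseteq> I" "\<And>j. j \<in> J \<Longrightarrow> P (D j \<union> T j)" for J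
  proof (rule chain)
    show "P X" if "X \<in> (\<lambda>i. D i \<union> T i) ` J" for X using that J by blast
    show "X \<subseteq> Y \<or> Y \<subseteq> X"
      if XY: "X \<in> (\<lambda>i. D i \<union> T i) ` J" "Y \<in> (\<lambda>i. D i \<union> T i) ` J" for X Y
    proof -
      obtain h i where "h \<in> I" "i \<in> I" "X = D h \<union> T h" "Y = D i \<union> T i"
        using XY J(1) by blast
      then show ?thesis using cmp by simp
    qed
  qed
  have ok: "P (D i) \<and> finite (T i) \<and> P (D i \<union> T i) \<and> R i (D i \<union> T i)" if "i \<in> I" for i
    using wf that
  proof (induction i rule: wf_induct_rule)
    case (less i)
    have IH: "finite (T h) \<and> P (D h \<union> T h)" if "h \<in> underS ?r i" for h
      using less.IH[of h] that Fld by (auto simp: underS_def)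
    have D: "D i = \<Union>((\<lambda>h. D h \<union> T h) ` underS ?r i)"
    proof
      show "D i \<subseteq> \<Union>((\<lambda>h. D h \<union> T h) ` underS ?r i)"
        unfolding D_def[of i] by blast
      show "\<Union>((\<lambda>h. D h \<union> T h) ` underS ?r i) \<subseteq> D i"
        by (rule UN_least) (auto simp: underS_def intro: subsetD[OF sub])
    qed
    have P: "P (D i)"
      unfolding D by (rule P_UN) (use IH Fld in \<open>auto simp: underS_def\<close>)
    have "|D i| <o ?r"
      unfolding D_def using less.prems inf IH
      by (intro ordLess_UNION_finite card_of_underS) (auto simp: card_of_card_order_on Field_card_of)
    from someI_ex[OF step[OF less.prems P this]] show ?case
      using P unfolding T[of i] E_def by blast
  qed
  show thesis
  proof
    show "P (\<Union>((\<lambda>i. D i \<union> T i) ` I))"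
      by (rule P_UN) (use ok in auto)
    show "R i (\<Union>((\<lambda>i. D i \<union> T i) ` I))" if "i \<in> I" for i
      by (rule mono[of i "D i \<union> T i"]) (use ok[OF that] that in auto)
  qed
qed

section \<open>Sidon sets\<close>

context comm_group
begin

text \<open>
  Since \<open>a b = c d\<close> means \<open>a / c = d / b\<close>, this says that every nontrivial quotient of elements of
  \<open>S\<close> arises from only one pair. The form with products keeps inverses out of the case analyses.
\<close>

definition sidon :: "'a set \<Rightarrow> bool" where
  "sidon S \<longleftrightarrow> S \<subseteq> carrier G \<and>
    (\<forall>a\<in>S. \<forall>b\<in>S. \<forall>c\<in>S. \<forall>d\<in>S. a \<otimes> b = c \<otimes> d \<longrightarrow> a = c \<and> b = d \<or> a = d \<and> b = c)"

lemma sidonD: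
  assumes "sidon S" "a \<in> S" "b \<in> S" "c \<in> S" "d \<in> S" "a \<otimes> b = c \<otimes> d"
  shows "a = c \<and> b = d \<or> a = d \<and> b = c"
  using assms unfolding sidon_def by blast

lemma sidon_Union_chain:
  assumes sid: "\<And>X. X \<in> \<C> \<Longrightarrow> sidon X"
    and chain: "\<And>X Y. \<lbrakk>X \<in> \<C>; Y \<in> \<C>\<rbrakk> \<Longrightarrow> X \<subseteq> Y \<or> Y \<subseteq> X"
  shows "sidon (\<Union>\<C>)"
  unfolding sidon_def
proof (intro conjI ballI impI)
  show "\<Union>\<C> \<subseteq> carrier G" using sid by (auto simp: sidon_def)
  fix a b c d
  assume abcd: "a \<in> \<Union>\<C>" "b \<in> \<Union>\<C>" "c \<in> \<Union>\<C>" "d \<in> \<Union>\<C>" and eq: "a \<otimes> b = c \<otimes> d"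
  have C: "subset.chain UNIV \<C>"
    using chain by (auto simp: subset.chain_def)
  have F: "finite {a, b, c, d}" "{a, b, c, d} \<subseteq> \<Union>\<C>" "\<C> \<noteq> {}" using abcd by auto
  obtain X where X: "X \<in> \<C>" "{a, b, c, d} \<subseteq> X"
    by (rule finite_subset_Union_chain[OF F C])
  show "a = c \<and> b = d \<or> a = d \<and> b = c"
    by (rule sidonD[OF sid[OF X(1)]]) (use X eq in auto)
qed

text \<open>
  In an equation between two products over \<open>S \<union> {x}\<close> the element \<open>x\<close> can be cancelled if it occurs
  on both sides; the two hypotheses exclude that it occurs on one side only. The second one with
  \<open>a = x\<close>, \<open>b = c\<close> shows that it also forces \<open>x \<notin> S\<close>.
\<close>

lemma sidon_insert:
  assumes S: "sidon S" and x: "x \<in> carrier G"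
    and sq: "\<And>a b. \<lbrakk>a \<in> S; b \<in> S\<rbrakk> \<Longrightarrow> x \<otimes> x \<noteq> a \<otimes> b"
    and pr: "\<And>a b c. \<lbrakk>a \<in> S; b \<in> S; c \<in> S\<rbrakk> \<Longrightarrow> x \<otimes> c \<noteq> a \<otimes> b"
  shows "sidon (insert x S)"
proof -
  have SG: "a \<in> carrier G" if "a \<in> S" for a using S that by (auto simp: sidon_def)
  have pr': "c \<otimes> x \<noteq> a \<otimes> b" if "a \<in> S" "b \<in> S" "c \<in> S" for a b c
    using pr[OF that] m_comm[of c x] SG that x by simp
  have can: "x \<otimes> a = x \<otimes> b \<Longrightarrow> a = b" "a \<otimes> x = b \<otimes> x \<Longrightarrow> a = b"
    "x \<otimes> a = b \<otimes> x \<Longrightarrow> a = b" "a \<otimes> x = x \<otimes> b \<Longrightarrow> a = b"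
    if "a \<in> insert x S" "b \<in> insert x S" for a b
  proof -
    have "a \<in> carrier G" "b \<in> carrier G" using that SG x by auto
    then show "x \<otimes> a = x \<otimes> b \<Longrightarrow> a = b" "a \<otimes> x = b \<otimes> x \<Longrightarrow> a = b"
      "x \<otimes> a = b \<otimes> x \<Longrightarrow> a = b" "a \<otimes> x = x \<otimes> b \<Longrightarrow> a = b"
      using x by (simp_all add: m_comm[of _ x])
  qed
  have ne: "c \<otimes> d \<noteq> a \<otimes> b" "a \<otimes> b \<noteq> c \<otimes> d"
    if "a \<in> S" "b \<in> S" "c \<in> insert x S" "d \<in> insert x S" "x \<in> {c, d}" for a b c d
    using sq[OF that(1,2)] pr[OF that(1,2)] pr'[OF that(1,2)] that(3-) by (metis insertE singletonD)+
  show ?thesis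
    unfolding sidon_def
  proof (intro conjI ballI impI)
    show "insert x S \<subseteq> carrier G" using SG x by auto
    fix a b c d
    assume m: "a \<in> insert x S" "b \<in> insert x S" "c \<in> insert x S" "d \<in> insert x S"
      and eq: "a \<otimes> b = c \<otimes> d"
    consider "x \<in> {a, b}" "x \<in> {c, d}" | "x \<in> {a, b}" "x \<notin> {c, d}"
      | "x \<notin> {a, b}" "x \<in> {c, d}" | "x \<notin> {a, b}" "x \<notin> {c, d}" by blast
    then show "a = c \<and> b = d \<or> a = d \<and> b = c"
    proof cases
      case 1
      then show ?thesis using can[of b d] can[of b c] can[of a d] can[of a c] m eq by blast
    next
      case 2
      then show ?thesis using ne[of c d a b] m eq by blast
    next
      case 3
      then show ?thesis using ne[of a b c d] m eq by blast
    next
      case 4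
      then show ?thesis using m eq sidonD[OF S, of a b c d] by blast
    qed
  qed
qed

lemma square_inj:
  assumes "\<And>x. \<lbrakk>x \<in> carrier G; x \<otimes> x = \<one>\<rbrakk> \<Longrightarrow> x = \<one>"
  shows "inj_on (\<lambda>x. x \<otimes> x) (carrier G)"
proof (rule inj_onI)
  fix x y assume x: "x \<in> carrier G" "y \<in> carrier G" and eq: "x \<otimes> x = y \<otimes> y"
  have "(x \<otimes> inv y) \<otimes> (x \<otimes> inv y) = (x \<otimes> x) \<otimes> inv (y \<otimes> y)"
    using x by (simp add: inv_mult m_ac)
  also have "\<dots> = \<one>" using eq x by simp
  finally have "x \<otimes> inv y = \<one>" by (rule assms[rotated]) (use x in simp)
  then show "x = y" using x inv_solve_right'[of \<one> x y] by simp
qed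

text \<open>
  Each excluded equation puts \<open>x\<close> or \<open>x\<^sup>2\<close> into the set \<open>W\<close> of words \<open>a b / (c d)\<close> over \<open>K\<close>,
  and \<open>W\<close> is smaller than the group since \<open>K\<close> is. The equations in \<open>x\<^sup>2\<close> do not exclude more
  elements than that, because squaring is injective.
\<close>

lemma exists_generic_element:
  assumes inf: "infinite (carrier G)"
    and no_inv: "\<And>x. \<lbrakk>x \<in> carrier G; x \<otimes> x = \<one>\<rbrakk> \<Longrightarrow> x = \<one>"
    and K: "K \<subseteq> carrier G" and small: "|K| <o |carrier G|"
  obtains x where "x \<in> carrier G"
    and "\<And>a b c d. \<lbrakk>a \<in> K; b \<in> K; c \<in> K; d \<in> K\<rbrakk> \<Longrightarrow> x \<otimes> (c \<otimes> d) \<noteq> a \<otimes> b"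
    and "\<And>a b c d. \<lbrakk>a \<in> K; b \<in> K; c \<in> K; d \<in> K\<rbrakk> \<Longrightarrow> x \<otimes> x \<otimes> (c \<otimes> d) \<noteq> a \<otimes> b"
proof -
  define W where "W = (\<lambda>((a, b), (c, d)). a \<otimes> b \<otimes> inv (c \<otimes> d)) ` ((K \<times> K) \<times> (K \<times> K))"
  define V where "V = {x \<in> carrier G. x \<otimes> x \<in> W}"
  have W: "|W| <o |carrier G|"
    unfolding W_def using ordLess_Times_same[OF inf ordLess_Times_same[OF inf small]]
    by (rule ordLeq_ordLess_trans[OF card_of_image])
  have "|V| \<le>o |W|"
    using inj_on_subset[OF square_inj[OF no_inv], of V]
    by (intro card_of_ordLeqI[of "\<lambda>x. x \<otimes> x"]) (auto simp: V_def)
  then have "|V| <o |carrier G|" using W by (rule ordLeq_ordLess_trans)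
  then have "|W \<union> V| <o |carrier G|" using W inf by (intro card_of_Un_ordLess_infinite)
  then have "\<not> carrier G \<subseteq> W \<union> V"
    using card_of_mono1 not_ordLess_ordLeq by blast
  then obtain x where x: "x \<in> carrier G" "x \<notin> W" "x \<otimes> x \<notin> W" by (auto simp: V_def)
  have ne: "y \<otimes> (c \<otimes> d) \<noteq> a \<otimes> b"
    if "y \<in> carrier G" "y \<notin> W" "a \<in> K" "b \<in> K" "c \<in> K" "d \<in> K" for y a b c d
  proof
    assume "y \<otimes> (c \<otimes> d) = a \<otimes> b"
    then have "y = a \<otimes> b \<otimes> inv (c \<otimes> d)"
      using that K by (intro inv_solve_right[THEN iffD2]) auto
    then show False using that by (force simp: W_def)
  qed
  show thesis
    by (rule that[of x]) (use x ne in auto)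
qed

text \<open>
  Unless \<open>g\<close> is already a quotient of elements of \<open>S\<close>, the new elements are \<open>x\<close> and \<open>g x\<close> for
  an \<open>x\<close> generic over \<open>K = S \<union> {\<one>, g}\<close>, inserted one after the other;
  \<open>\<one> \<in> K\<close> makes genericity cover shorter words too. An equation that could destroy the Sidon
  property is excluded by genericity, possibly after cancelling an \<open>x\<close>, unless cancelling leaves
  \<open>g c = b\<close> with \<open>b, c \<in> S\<close>, \<open>g = \<one>\<close>, or \<open>g\<^sup>2 = \<one>\<close>, all of which are impossible.
\<close>

lemma sidon_extend_quotient:
  assumes inf: "infinite (carrier G)"
    and no_inv: "\<And>x. \<lbrakk>x \<in> carrier G; x \<otimes> x = \<one>\<rbrakk> \<Longrightarrow> x = \<one>"
    and S: "sidon S" and small: "|S| <o |carrier G|"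
    and g: "g \<in> carrier G" "g \<noteq> \<one>"
  shows "\<exists>T. finite T \<and> sidon (S \<union> T) \<and> (\<exists>a\<in>S \<union> T. \<exists>b\<in>S \<union> T. g \<otimes> a = b)"
proof (cases "\<exists>a\<in>S. \<exists>b\<in>S. g \<otimes> a = b")
  case True
  then show ?thesis using S by (intro exI[of _ "{}"]) simp
next
  case False
  then have noq: "g \<otimes> a \<noteq> b" if "a \<in> S" "b \<in> S" for a b using that by blast
  have SG: "a \<in> carrier G" if "a \<in> S" for a using S that by (auto simp: sidon_def)
  define K where "K = {\<one>, g} \<union> S"
  have K: "K \<subseteq> carrier G" using SG g by (auto simp: K_def)
  have "|{\<one>, g}| <o |carrier G|"
    using inf by (intro finite_ordLess_card) auto
  then have "|K| <o |carrier G|"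
    unfolding K_def using small inf by (intro card_of_Un_ordLess_infinite)
  then obtain x where x: "x \<in> carrier G"
    and n1: "\<And>a b c d. \<lbrakk>a \<in> K; b \<in> K; c \<in> K; d \<in> K\<rbrakk> \<Longrightarrow> x \<otimes> (c \<otimes> d) \<noteq> a \<otimes> b"
    and n2: "\<And>a b c d. \<lbrakk>a \<in> K; b \<in> K; c \<in> K; d \<in> K\<rbrakk> \<Longrightarrow> x \<otimes> x \<otimes> (c \<otimes> d) \<noteq> a \<otimes> b"
    using exists_generic_element[OF inf no_inv K] by metis
  have K': "\<one> \<in> K" "g \<in> K" "\<And>a. a \<in> S \<Longrightarrow> a \<in> K" by (auto simp: K_def)
  have Sx: "sidon (insert x S)"
  proof (rule sidon_insert[OF S x])
    show "x \<otimes> x \<noteq> a \<otimes> b" if "a \<in> S" "b \<in> S" for a b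
      using n2[of a b \<one> \<one>] K' that x by simp
    show "x \<otimes> c \<noteq> a \<otimes> b" if "a \<in> S" "b \<in> S" "c \<in> S" for a b c
      using n1[of a b c \<one>] K' that x SG by simp
  qed
  let ?y = "g \<otimes> x"
  have y: "?y \<in> carrier G" using x g by simp
  have "sidon (insert ?y (insert x S))"
  proof (rule sidon_insert[OF Sx y])
    fix a b assume ab: "a \<in> insert x S" "b \<in> insert x S"
    (* Two factorisations of the square of g x: the first isolates x x against products from S, the
       second isolates one x, to be cancelled against an x on the other side. *)
    have 1: "g \<otimes> x \<otimes> (g \<otimes> x) = x \<otimes> x \<otimes> (g \<otimes> g)" using x g by (simp add: m_ac)
    have 2: "g \<otimes> x \<otimes> (g \<otimes> x) = x \<otimes> (x \<otimes> (g \<otimes> g))" using x g by (simp add: m_ac)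
    show "?y \<otimes> ?y \<noteq> a \<otimes> b"
    proof (cases "a \<in> S \<and> b \<in> S")
      case True
      then show ?thesis using n2[of a b g g] K' 1 by simp
    next
      case False
      have 3: "x \<otimes> (g \<otimes> g) \<noteq> c" if "c \<in> insert x S" for c
      proof
        assume eq: "x \<otimes> (g \<otimes> g) = c"
        show False
        proof (cases "c = x")
          case True
          then have "g \<otimes> g = \<one>" using eq x g by simp
          then show False using no_inv g by blast
        next
          case False
          then show False using that eq n1[of c \<one> g g] K' SG by simp
        qed
      qed
      have 4: "g \<otimes> x \<otimes> (g \<otimes> x) \<noteq> x \<otimes> c" if "c \<in> insert x S" for c
        unfolding 2 using 3[OF that] that x g SG by auto
      from False ab show ?thesis
        using 4[of a] 4[of b] m_comm[of a x] x SG by auto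
    qed
  next
    fix a b c assume abc: "a \<in> insert x S" "b \<in> insert x S" "c \<in> insert x S"
    have ca: "a \<in> carrier G" "b \<in> carrier G" "c \<in> carrier G" using abc x SG by auto
    have nc: "g \<otimes> c \<noteq> b" if bc: "b \<in> insert x S" "c \<in> insert x S" for b c
    proof
      assume eq: "g \<otimes> c = b"
      consider "b = x" "c = x" | "b = x" "c \<in> S" | "b \<in> S" "c = x" | "b \<in> S" "c \<in> S"
        using bc by blast
      then show False
      proof cases
        case 1
        then show False using eq x g by simp
      next
        case 2
        then show False using eq n1[of g c \<one> \<one>] K' x by simp
      next
        case 3
        then show False using eq n1[of b \<one> g \<one>] K' x g SG m_comm[of g x] by simp
      next
        case 4
        then show False using noq eq by blast
      qed
    qed
    have nx: "?y \<otimes> c \<noteq> x \<otimes> b" if "b \<in> insert x S" for b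
    proof -
      have "?y \<otimes> c = x \<otimes> (g \<otimes> c)" using x g ca by (simp add: m_ac)
      then show ?thesis using nc[OF that abc(3)] that x g ca SG by auto
    qed
    show "?y \<otimes> c \<noteq> a \<otimes> b"
    proof (cases "a \<in> S \<and> b \<in> S")
      case ab: True
      show ?thesis
      proof (cases "c = x")
        case True
        have "?y \<otimes> x = x \<otimes> x \<otimes> (g \<otimes> \<one>)" using x g by (simp add: m_ac)
        then show ?thesis using True ab n2[of a b g \<one>] K' by simp
      next
        case False
        have "?y \<otimes> c = x \<otimes> (g \<otimes> c)" using x g ca by (simp add: m_ac)
        then show ?thesis using False abc ab n1[of a b g c] K' by simp
      qed
    next
      case False
      then show ?thesis using nx[of a] nx[of b] abc m_comm[of a x] x ca by auto
    qed
  qed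
  then show ?thesis
    by (intro exI[of _ "{?y, x}"]) (auto simp: Un_commute)
qed

lemma exists_planar_difference_set:
  assumes inf: "infinite (carrier G)"
    and no_inv: "\<And>x. \<lbrakk>x \<in> carrier G; x \<otimes> x = \<one>\<rbrakk> \<Longrightarrow> x = \<one>"
  obtains D where "sidon D"
    and "\<And>g. \<lbrakk>g \<in> carrier G; g \<noteq> \<one>\<rbrakk> \<Longrightarrow> \<exists>a\<in>D. \<exists>b\<in>D. g \<otimes> a = b"
proof (rule transfinite_extension[of "carrier G" sidon
      "\<lambda>g D. g \<noteq> \<one> \<longrightarrow> (\<exists>a\<in>D. \<exists>b\<in>D. g \<otimes> a = b)"])
  show "infinite (carrier G)" by (rule inf)
  show "sidon (\<Union>\<C>)"
    if "\<And>X. X \<in> \<C> \<Longrightarrow> sidon X" "\<And>X Y. \<lbrakk>X \<in> \<C>; Y \<in> \<C>\<rbrakk> \<Longrightarrow> X \<subseteq> Y \<or> Y \<subseteq> X" for \<C>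
    using that by (rule sidon_Union_chain)
  show "g \<noteq> \<one> \<longrightarrow> (\<exists>a\<in>Y. \<exists>b\<in>Y. g \<otimes> a = b)"
    if "g \<noteq> \<one> \<longrightarrow> (\<exists>a\<in>X. \<exists>b\<in>X. g \<otimes> a = b)" "X \<subseteq> Y" for g X Y
    using that by blast
  show "\<exists>T. finite T \<and> sidon (X \<union> T) \<and>
      (g \<noteq> \<one> \<longrightarrow> (\<exists>a\<in>X \<union> T. \<exists>b\<in>X \<union> T. g \<otimes> a = b))"
    if *: "g \<in> carrier G" "sidon X" "|X| <o |carrier G|" for g X
  proof (cases "g = \<one>")
    case True
    then show ?thesis using * by (intro exI[of _ "{}"]) simp
  next
    case False
    then show ?thesis using sidon_extend_quotient[OF inf no_inv *(2,3,1)] by blast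
  qed
qed (use that in blast)

end

section \<open>The plane of a planar difference set\<close>

text \<open>
  For an infinite group the set \<open>D\<close> is infinite, which gives the plane its quadrangle; small finite
  planar difference sets may yield only a degenerate plane.
\<close>

locale planar_difference_set = comm_group G for G (structure) +
  fixes D :: "'a set"
  assumes sidon: "sidon D"
    and quotient: "\<lbrakk>g \<in> carrier G; g \<noteq> \<one>\<rbrakk> \<Longrightarrow> \<exists>a\<in>D. \<exists>b\<in>D. g \<otimes> a = b"
    and infinite_carrier: "infinite (carrier G)"
begin

definition translates :: "'a set set" where
  "translates = (\<lambda>g. g <# D) ` carrier G"

lemma D_closed: "a \<in> D \<Longrightarrow> a \<in> carrier G"
  using sidon by (auto simp: sidon_def)

lemma mem_translate: "x \<in> g <# D \<longleftrightarrow> (\<exists>a\<in>D. x = g \<otimes> a)"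
  by (auto simp: l_coset_def)

text \<open>
  From \<open>b = g a\<close> and \<open>b' = g a'\<close> follows \<open>a b' = a' b\<close>. By the Sidon property \<open>a = a'\<close> or
  \<open>a = b\<close>, and the latter means \<open>g = \<one>\<close>.
\<close>

lemma quotient_unique:
  assumes g: "g \<in> carrier G" "g \<noteq> \<one>"
    and D: "a \<in> D" "a' \<in> D" "g \<otimes> a \<in> D" "g \<otimes> a' \<in> D"
  shows "a = a'"
proof -
  have "a \<otimes> (g \<otimes> a') = a' \<otimes> (g \<otimes> a)"
    using g D by (simp add: D_closed m_ac)
  with sidonD[OF sidon D(1,4,2,3)] have "a = a' \<or> a = g \<otimes> a" by blast
  then show ?thesis using g D by (auto simp: D_closed)
qed

text \<open>A finite set has finitely many quotients, but those of \<open>D\<close> exhaust an infinite group.\<close>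

lemma infinite_D: "infinite D"
proof
  assume "finite D"
  moreover have "carrier G \<subseteq> insert \<one> ((\<lambda>(a, b). b \<otimes> inv a) ` (D \<times> D))"
  proof
    fix g assume g: "g \<in> carrier G"
    show "g \<in> insert \<one> ((\<lambda>(a, b). b \<otimes> inv a) ` (D \<times> D))"
    proof (cases "g = \<one>")
      case False
      with quotient g obtain a where a: "a \<in> D" "g \<otimes> a \<in> D" by blast
      then have "g = g \<otimes> a \<otimes> inv a" using g D_closed by (simp add: m_assoc)
      then show ?thesis using a by force
    qed simp
  qed
  ultimately show False
    using infinite_carrier by (meson finite_SigmaI finite_imageI finite_insert finite_subset)
qed

text \<open>
  A common point is a solution of \<open>h a = k b\<close> in \<open>D\<close>, that is, a representation of \<open>h / k\<close> as
  the quotient \<open>b / a\<close>.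
\<close>

lemma translates_meet:
  assumes h: "h \<in> carrier G" and k: "k \<in> carrier G" and "h \<noteq> k"
  shows "\<exists>!x. x \<in> h <# D \<and> x \<in> k <# D"
proof -
  let ?g = "inv k \<otimes> h"
  have g: "?g \<in> carrier G" "?g \<noteq> \<one>"
    using h k \<open>h \<noteq> k\<close> by (auto simp: inv_solve_left')
  have iff: "h \<otimes> a = k \<otimes> b \<longleftrightarrow> ?g \<otimes> a = b" if "a \<in> D" "b \<in> D" for a b
    using that h k D_closed by (metis inv_closed inv_solve_left m_assoc m_closed)
  obtain a b where ab: "a \<in> D" "b \<in> D" "?g \<otimes> a = b" using quotient[OF g] by blast
  show ?thesis
  proof (rule ex1I[of _ "h \<otimes> a"])
    show "h \<otimes> a \<in> h <# D \<and> h \<otimes> a \<in> k <# D"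
      using ab iff by (auto simp: mem_translate)
    fix y assume "y \<in> h <# D \<and> y \<in> k <# D"
    then obtain a' b' where "a' \<in> D" "b' \<in> D" "y = h \<otimes> a'" "h \<otimes> a' = k \<otimes> b'"
      by (auto simp: mem_translate)
    then show "y = h \<otimes> a" using quotient_unique[OF g] ab iff by blast
  qed
qed

text \<open>If \<open>h \<noteq> k\<close>, the translates share a single point, whereas each has at least two.\<close>

lemma translates_eq_iff:
  assumes "h \<in> carrier G" "k \<in> carrier G"
  shows "h <# D = k <# D \<longleftrightarrow> h = k"
proof
  assume eq: "h <# D = k <# D"
  obtain a b where ab: "a \<in> D" "b \<in> D" "a \<noteq> b"
    using infinite_D by (metis finite.simps finite_insert insertCI subsetI subset_singletonD)
  show "h = k"
  proof (rule ccontr)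
    assume "h \<noteq> k"
    then have "h \<otimes> a = h \<otimes> b"
      using translates_meet[OF assms] ab eq by (metis mem_translate)
    then show False using ab assms D_closed by simp
  qed
qed simp

text \<open>
  A line \<open>h D\<close> through \<open>x = h a\<close> contains \<open>y\<close> iff \<open>(y / x) a \<in> D\<close>; this determines \<open>a\<close> and hence
  \<open>h = x / a\<close>.
\<close>

lemma translates_join:
  assumes x: "x \<in> carrier G" and y: "y \<in> carrier G" and "x \<noteq> y"
  shows "\<exists>!l. l \<in> translates \<and> x \<in> l \<and> y \<in> l"
proof -
  let ?g = "inv x \<otimes> y"
  have g: "?g \<in> carrier G" "?g \<noteq> \<one>"
    using x y \<open>x \<noteq> y\<close> by (auto simp: inv_solve_left')
  have y_eq: "y = x \<otimes> ?g" using x y by (simp add: m_assoc[symmetric])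
  have iff: "y = h \<otimes> b \<longleftrightarrow> ?g \<otimes> a = b"
    if "h \<in> carrier G" "a \<in> D" "b \<in> D" "x = h \<otimes> a" for h a b
  proof -
    have "y = h \<otimes> (?g \<otimes> a)"
      using y_eq that x y D_closed by (metis g(1) m_assoc m_comm)
    then show ?thesis using that g D_closed by auto
  qed
  obtain a b where ab: "a \<in> D" "b \<in> D" "?g \<otimes> a = b" using quotient[OF g] by blast
  let ?h = "x \<otimes> inv a"
  have h: "?h \<in> carrier G" "x = ?h \<otimes> a" using x ab D_closed by (auto simp: m_assoc)
  show ?thesis
  proof (rule ex1I[of _ "?h <# D"])
    show "?h <# D \<in> translates \<and> x \<in> ?h <# D \<and> y \<in> ?h <# D"
      using ab h iff[OF h(1) ab(1,2) h(2)] by (auto simp: translates_def mem_translate)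
    fix l assume "l \<in> translates \<and> x \<in> l \<and> y \<in> l"
    then obtain k a' b' where k: "k \<in> carrier G" "l = k <# D"
      "a' \<in> D" "b' \<in> D" "x = k \<otimes> a'" "y = k \<otimes> b'"
      by (auto simp: translates_def mem_translate)
    then have "a' = a"
      using quotient_unique[OF g, of a' a] ab iff[OF k(1,3,4,5)] by simp
    then have "k = ?h" using k x ab D_closed by (intro inv_solve_right[THEN iffD2]) auto
    then show "l = ?h <# D" using k by simp
  qed
qed

text \<open>
  Take two lines meeting in \<open>p\<close> and two further points on each. A third line meets each of the
  two lines in at most one point, so it contains at most one point of each pair.
\<close>

lemma translate_quadrangle:
  "\<exists>Q \<subseteq> carrier G. card Q = 4 \<and> (\<forall>l \<in> translates. card (Q \<inter> l) \<le> 2)"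
proof -
  obtain g where g: "g \<in> carrier G" "g \<noteq> \<one>"
    using infinite_carrier by (metis finite.simps finite_insert insertCI subsetI finite_subset)
  let ?l = "\<one> <# D" and ?m = "g <# D"
  have lm: "?l \<in> translates" "?m \<in> translates" "?l \<noteq> ?m"
    using g translates_eq_iff[of \<one> g] by (auto simp: translates_def)
  obtain p where p: "?l \<inter> ?m = {p}"
  proof -
    have "\<exists>!x. x \<in> ?l \<and> x \<in> ?m" using g by (intro translates_meet) auto
    then show thesis using that by blast
  qed
  have sub: "l \<subseteq> carrier G" if "l \<in> translates" for l
    using that D_closed by (auto simp: translates_def mem_translate)
  have "\<exists>B. B \<subseteq> l - {p} \<and> finite B \<and> card B = 2" if l: "l \<in> translates" for l
  proof -
    obtain h where h: "h \<in> carrier G" "l = h <# D" using l by (auto simp: translates_def)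
    have "l = (\<lambda>a. h \<otimes> a) ` D" using h by (auto simp: mem_translate)
    moreover have "inj_on (\<lambda>a. h \<otimes> a) D" using h D_closed by (auto simp: inj_on_def)
    ultimately have "infinite (l - {p})" using infinite_D by (simp add: finite_image_iff)
    then show ?thesis using infinite_arbitrarily_large by metis
  qed
  from this[OF lm(1)] this[OF lm(2)] obtain B C where
    B: "B \<subseteq> ?l - {p}" "finite B" "card B = 2" and C: "C \<subseteq> ?m - {p}" "finite C" "card C = 2"
    by blast
  have disj: "B \<inter> ?m = {}" "C \<inter> ?l = {}" using B C p by auto
  have le1: "card (X \<inter> n) \<le> 1" if "X \<subseteq> l" "finite X" "l \<in> translates" "n \<in> translates" "n \<noteq> l" for X l n
  proof -
    have "x = y" if "x \<in> X \<inter> n" "y \<in> X \<inter> n" for x y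
      using that \<open>X \<subseteq> l\<close> \<open>l \<in> translates\<close> \<open>n \<in> translates\<close> \<open>n \<noteq> l\<close> sub translates_join[of x y]
      by (metis IntD1 IntD2 subsetD)
    then show ?thesis using \<open>finite X\<close> card_le_Suc0_iff_eq[of "X \<inter> n"] by auto
  qed
  show ?thesis
  proof (intro exI[of _ "B \<union> C"] conjI ballI)
    show "B \<union> C \<subseteq> carrier G" using B C sub[OF lm(1)] sub[OF lm(2)] by auto
    have "B \<inter> C = {}" using disj B by auto
    then show "card (B \<union> C) = 4" using B C by (simp add: card_Un_disjoint)
    fix n assume n: "n \<in> translates"
    have split: "(B \<union> C) \<inter> n = (B \<inter> n) \<union> (C \<inter> n)" by blast
    consider "n = ?l" | "n = ?m" | "n \<noteq> ?l" "n \<noteq> ?m" by blast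
    then show "card ((B \<union> C) \<inter> n) \<le> 2"
    proof cases
      case 1
      then have "(B \<union> C) \<inter> n = B" using B disj by auto
      then show ?thesis using B by simp
    next
      case 2
      then have "(B \<union> C) \<inter> n = C" using C disj by auto
      then show ?thesis using C by simp
    next
      case 3
      then have "card (B \<inter> n) \<le> 1" "card (C \<inter> n) \<le> 1"
        using le1[of B ?l n] le1[of C ?m n] B C lm n by auto
      then show ?thesis
        unfolding split using card_Un_le[of "B \<inter> n" "C \<inter> n"] by linarith
    qed
  qed
qed

lemma translates_projective_plane: "projective_plane (carrier G) translates"
proof
  show sub: "l \<subseteq> carrier G" if "l \<in> translates" for l
    using that D_closed by (auto simp: translates_def mem_translate)
  show "\<exists>!l. l \<in> translates \<and> x \<in> l \<and> y \<in> l"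
    if "x \<in> carrier G" "y \<in> carrier G" "x \<noteq> y" for x y
    by (rule translates_join[OF that])
  show "\<exists>!x. x \<in> carrier G \<and> x \<in> l \<and> x \<in> m"
    if lm: "l \<in> translates" "m \<in> translates" "l \<noteq> m" for l m
  proof -
    obtain h k where "h \<in> carrier G" "k \<in> carrier G" "l = h <# D" "m = k <# D"
      using lm by (auto simp: translates_def)
    then have "\<exists>!x. x \<in> l \<and> x \<in> m" using lm translates_meet[of h k] by auto
    then show ?thesis using sub[OF lm(1)] by blast
  qed
  show "\<exists>Q \<subseteq> carrier G. card Q = 4 \<and> (\<forall>l \<in> translates. card (Q \<inter> l) \<le> 2)"
    by (rule translate_quadrangle)
qed

end

section \<open>Translations as collineations\<close>

definition left_translation :: "('a, 'b) monoid_scheme \<Rightarrow> 'a \<Rightarrow> 'a \<Rightarrow> 'a" where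
  "left_translation G g = (\<lambda>x\<in>carrier G. g \<otimes>\<^bsub>G\<^esub> x)"

lemma (in group) left_translation_hom: "left_translation G \<in> hom G (BijGroup (carrier G))"
proof (rule homI)
  have bij: "bij_betw (left_translation G g) (carrier G) (carrier G)" if "g \<in> carrier G" for g
    using that by (intro bij_betwI[where g = "\<lambda>x. inv g \<otimes> x"])
      (auto simp: left_translation_def m_assoc[symmetric])
  fix g assume g: "g \<in> carrier G"
  from bij[OF g] show "left_translation G g \<in> carrier (BijGroup (carrier G))"
    by (auto simp: BijGroup_def Bij_def left_translation_def)
  fix h assume h: "h \<in> carrier G"
  show "left_translation G (g \<otimes> h) =
      left_translation G g \<otimes>\<^bsub>BijGroup (carrier G)\<^esub> left_translation G h"
    using bij[OF g] bij[OF h] g h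
    by (auto simp: BijGroup_def Bij_def left_translation_def compose_def m_assoc fun_eq_iff)
qed

lemma (in group) left_translation_sharply_transitive:
  "sharply_transitive G (left_translation G) (carrier G)"
  unfolding sharply_transitive_def
proof (intro ballI)
  fix x y assume xy: "x \<in> carrier G" "y \<in> carrier G"
  show "\<exists>!g. g \<in> carrier G \<and> left_translation G g x = y"
    using xy by (intro ex1I[of _ "y \<otimes> inv x"])
      (auto simp: left_translation_def m_assoc)
qed

lemma (in planar_difference_set) left_translation_collineation:
  assumes g: "g \<in> carrier G"
  shows "left_translation G g \<in> collineations (carrier G) translates"
proof -
  have "left_translation G g ` (h <# D) = (g \<otimes> h) <# D" if "h \<in> carrier G" for h
    using that g D_closed by (force simp: left_translation_def l_coset_def image_iff m_assoc)
  then have "(\<lambda>l. left_translation G g ` l) ` translates = (\<lambda>h. (g \<otimes> h) <# D) ` carrier G"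
    by (simp add: translates_def image_image)
  also have "\<dots> = (\<lambda>h. h <# D) ` (\<lambda>h. g \<otimes> h) ` carrier G"
    by (simp add: image_image)
  also have "\<dots> = translates"
    using surj_const_mult[OF g] by (simp add: translates_def)
  finally show ?thesis
    using hom_in_carrier[OF left_translation_hom g] by (simp add: collineations_def BijGroup_def)
qed

lemma (in planar_difference_set) left_translation_hom_Aut:
  "left_translation G \<in> hom G (Aut (carrier G) translates)"
  using left_translation_hom left_translation_collineation
  by (auto simp: hom_def Aut_def)

theorem theorem1p1:
  fixes A :: "('a, 'b) monoid_scheme"
  assumes "comm_group A"
    and "infinite (carrier A)"
    and "\<not> has_involution A"
  shows "\<exists>(P :: 'a set) L H \<phi>.
    projective_plane P L \<and>
    subgroup H (Aut P L) \<and>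
    \<phi> \<in> iso A (Aut P L \<lparr>carrier := H\<rparr>) \<and>
    sharply_transitive A \<phi> P"
proof -
  interpret A: comm_group A by fact
  have no_inv: "x = \<one>\<^bsub>A\<^esub>" if x: "x \<in> carrier A" "x \<otimes>\<^bsub>A\<^esub> x = \<one>\<^bsub>A\<^esub>" for x
  proof -
    have "x [^]\<^bsub>A\<^esub> (2::nat) = \<one>\<^bsub>A\<^esub>" using x by (simp add: numeral_2_eq_2)
    then have "A.ord x dvd 2" using x by (simp add: A.pow_eq_id)
    moreover have "A.ord x \<noteq> 2" using assms(3) x by (auto simp: has_involution_def)
    ultimately have "A.ord x = 1"
      using dvd_imp_le[of "A.ord x" 2] by (cases "A.ord x = 0") auto
    then show ?thesis using x A.ord_eq_1 by blast
  qed
  obtain D where D: "A.sidon D"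
    "\<And>g. \<lbrakk>g \<in> carrier A; g \<noteq> \<one>\<^bsub>A\<^esub>\<rbrakk> \<Longrightarrow> \<exists>a\<in>D. \<exists>b\<in>D. g \<otimes>\<^bsub>A\<^esub> a = b"
    using A.exists_planar_difference_set[OF assms(2) no_inv] by blast
  interpret planar_difference_set A D
    by unfold_locales (use D assms(2) in auto)
  let ?Aut = "Aut (carrier A) translates" and ?\<phi> = "left_translation A"
  have hom: "group_hom A ?Aut ?\<phi>"
    using left_translation_hom_Aut projective_plane.group_Aut[OF translates_projective_plane]
    by (simp add: group_hom_def group_hom_axioms_def)
  have "inj_on ?\<phi> (carrier A)"
  proof (rule inj_onI)
    fix g h assume gh: "g \<in> carrier A" "h \<in> carrier A" "?\<phi> g = ?\<phi> h"
    then have "?\<phi> g \<one>\<^bsub>A\<^esub> = ?\<phi> h \<one>\<^bsub>A\<^esub>" by simp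
    then show "g = h" using gh by (simp add: left_translation_def)
  qed
  then have "?\<phi> \<in> iso A (?Aut \<lparr>carrier := ?\<phi> ` carrier A\<rparr>)"
    using left_translation_hom_Aut by (auto simp: iso_def hom_def bij_betw_def)
  then show ?thesis
    using translates_projective_plane group_hom.img_is_subgroup[OF hom]
      A.left_translation_sharply_transitive by blast
qed

end
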